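(* Let $(x,s)\in\mathcal{C}$ be a feasible first-stage decision, let $\xi\in\mathbb{Z}_{\ge0}^{|\mathcal{A}|}$ be a realization of demand, and let $\hat i\in\mathcal{I}$. Assume that $$\sum_{v\in\mathcal{V}}s_{v\hat i}<\sum_{j:(\hat i,j)\in\mathcal{A}}\xi_{\hat ij}.$$ Let $\hat P_{jl}=P_{\hat ijl}x_{\zeta(\hat i),\zeta(j),l}$ for $j\in\mathcal{J}_{\hat i}$, $l\in\mathcal{L}$. Enumerate the $|\mathcal{J}_{\hat i}|$ pairs $(j,l)\in\mathcal{J}_{\hat i}\times\mathcal{L}$ with $x_{\zeta(\hat i),\zeta(j),l}=1$ as $(j,l)^{(k)}=(j^{(k)},l^{(k)})$, $k=1,\ldots,|\mathcal{J}_{\hat i}|$, in non-increasing order of $\hat P_{jl}$. Let $\hat k$, $2\le\hat k\le|\mathcal{J}_{\hat i}|$, be such that $$\sum_{k=1}^{\hat k-1}\min\Big\{\xi_{\hat i,j^{(k)}},\Big\lfloor\theta_{\hat i,j^{(k)}}\sum_{v\in\mathcal{V}}s_{v\hat i}+1\Big\rfloor\Big\}\le\sum_{v\in\mathcal{V}}s_{v\hat i}\quad\text{and}\quad\sum_{k=1}^{\hat k}\min\Big\{\xi_{\hat i,j^{(k)}},\Big\lfloor\theta_{\hat i,j^{(k)}}\sum_{v\in\mathcal{V}}s_{v\hat i}+1\Big\rfloor\Big\}>\sum_{v\in\mathcal{V}}s_{v\hat i}.$$ Then an optimal solution to the problem $Q^{\hat i}(x,s,\xi)$ of the recourse problem with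 proportional vehicle assignment, namely $$\max\sum_{j\in\mathcal{J}_{\hat i}}\sum_{l\in\mathcal{L}}P_{\hat ijl}r_{jl}\ \text{ s.t. }\ r_{jl}\le\xi_{\hat ij}x_{\zeta(\hat i),\zeta(j),l},\ \ r_{jl}\le\theta_{\hat ij}\sum_{v\in\mathcal{V}}s_{v\hat i}+1,\ \ r_{jl}\in\mathbb{Z}_{\ge0}\ \ \forall j\in\mathcal{J}_{\hat i},\,l\in\mathcal{L};\quad\sum_{(j,l)\in\mathcal{J}_{\hat i}\times\mathcal{L}}r_{jl}\le\sum_{v\in\mathcal{V}}s_{v\hat i},$$ is $$\hat r_{jl}=\begin{cases}\min\{\xi_{\hat i,j},\lfloor\theta_{\hat i,j}\sum_{v\in\mathcal{V}}s_{v\hat i}+1\rfloor\}&\forall(j,l)\in\{(j,l)^{(1)},\ldots,(j,l)^{(\hat k-1)}\},\\ \sum_{v\in\mathcal{V}}s_{v\hat i}-\sum_{k=1}^{\hat k-1}\min\{\xi_{\hat i,j^{(k)}},\lfloor\theta_{\hat i,j^{(k)}}\sum_{v\in\mathcal{V}}s_{v\hat i}+1\rfloor\}&(j,l)=(j,l)^{(\hat k)},\\ 0&\forall(j,l)\in(\mathcal{J}_{\hat i}\times\mathcal{L})\setminus\{(j,l)^{(1)},\ldots,(j,l)^{(\hat k)}\}.\end{cases}$$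
   Context: $\mathcal{I}$ (stations), $\mathcal{Z}$ (zones), $\mathcal{L}$ (price levels), $\mathcal{V}$ (vehicles) are finite nonempty sets. $\mathcal{A}=\{(i,j): i,j\in\mathcal{I},\ i\ne j\}$. The stations are partitioned into zones, and $\zeta:\mathcal{I}\to\mathcal{Z}$ maps a station to its zone. $\mathcal{J}_i=\{j\in\mathcal{I}:(i,j)\in\mathcal{A}\}$. $P_{ijl}\ge 0$ is the rental price from station $i$ to station $j$ at price level $l$. $\theta_{ij}=\xi_{ij}/\sum_{k\in\mathcal{I},k\ne i}\xi_{ik}$ (the denominator is positive for $i=\hat i$ under the assumption of the claim). $\mathcal{C}$ is the set of pairs $(x,s)$ with $x=(x_{z_1,z_2,l})\in\{0,1\}^{|\mathcal{Z}|\times|\mathcal{Z}|\times|\mathcal{L}|}$ and $s=(s_{vi})\in\{0,1\}^{|\mathcal{V}|\times|\mathcal{I}|}$ such that $\sum_{l\in\mathcal{L}}x_{z_1,z_2,l}=1$ for all $z_1,z_2\in\mathcal{Z}$ and $\sum_{i\in\mathcal{I}}s_{vi}=1$ for all $v\in\mathcal{V}$. *)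

theory Defs
  imports Complex_Main
begin

text \<open>
  Stations, zones, price levels and vehicles are the elements of finite types
  \<open>'i\<close>, \<open>'z\<close>, \<open>'l\<close>, \<open>'v\<close>. Arc-indexed data are total functions
  \<open>'i \<Rightarrow> 'i \<Rightarrow> _\<close>; their values on the diagonal are never used.
\<close>

definition arcs :: "('i \<times> 'i) set" where
  "arcs = {(i, j). i \<noteq> j}"

definition dests :: "'i \<Rightarrow> 'i set" where
  "dests i = {j. (i, j) \<in> arcs}"

definition first_stage ::
  "(('z::finite \<Rightarrow> 'z \<Rightarrow> 'l::finite \<Rightarrow> int) \<times> ('v::finite \<Rightarrow> 'i::finite \<Rightarrow> int)) set" where
  "first_stage = {(x, s).
     (\<forall>z1 z2 l. x z1 z2 l \<in> {0, 1}) \<and>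
     (\<forall>v i. s v i \<in> {0, 1}) \<and>
     (\<forall>z1 z2. (\<Sum>l\<in>UNIV. x z1 z2 l) = 1) \<and>
     (\<forall>v. (\<Sum>i\<in>UNIV. s v i) = 1)}"

definition vehicles_at :: "('v::finite \<Rightarrow> 'i \<Rightarrow> int) \<Rightarrow> 'i \<Rightarrow> int" where
  "vehicles_at s i = (\<Sum>v\<in>UNIV. s v i)"

definition theta :: "('i::finite \<Rightarrow> 'i \<Rightarrow> int) \<Rightarrow> 'i \<Rightarrow> 'i \<Rightarrow> real" where
  "theta \<xi> i j = real_of_int (\<xi> i j) / real_of_int (\<Sum>k | k \<noteq> i. \<xi> i k)"

definition recourse_feasible ::
  "('i::finite \<Rightarrow> 'z) \<Rightarrow> ('z \<Rightarrow> 'z \<Rightarrow> 'l::finite \<Rightarrow> int) \<Rightarrow> ('v::finite \<Rightarrow> 'i \<Rightarrow> int) \<Rightarrow>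
   ('i \<Rightarrow> 'i \<Rightarrow> int) \<Rightarrow> 'i \<Rightarrow> ('i \<Rightarrow> 'l \<Rightarrow> int) \<Rightarrow> bool" where
  "recourse_feasible \<zeta> x s \<xi> i r \<longleftrightarrow>
     (\<forall>j\<in>dests i. \<forall>l.
        r j l \<le> \<xi> i j * x (\<zeta> i) (\<zeta> j) l \<and>
        real_of_int (r j l) \<le> theta \<xi> i j * real_of_int (vehicles_at s i) + 1 \<and>
        0 \<le> r j l) \<and>
     (\<Sum>(j, l)\<in>dests i \<times> UNIV. r j l) \<le> vehicles_at s i"

definition recourse_objective ::
  "('i::finite \<Rightarrow> 'i \<Rightarrow> 'l::finite \<Rightarrow> real) \<Rightarrow> 'i \<Rightarrow> ('i \<Rightarrow> 'l \<Rightarrow> int) \<Rightarrow> real" where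
  "recourse_objective P i r = (\<Sum>j\<in>dests i. \<Sum>l\<in>UNIV. P i j l * real_of_int (r j l))"

definition recourse_optimal ::
  "('i::finite \<Rightarrow> 'i \<Rightarrow> 'l::finite \<Rightarrow> real) \<Rightarrow> ('i \<Rightarrow> 'z) \<Rightarrow> ('z \<Rightarrow> 'z \<Rightarrow> 'l \<Rightarrow> int) \<Rightarrow>
   ('v::finite \<Rightarrow> 'i \<Rightarrow> int) \<Rightarrow> ('i \<Rightarrow> 'i \<Rightarrow> int) \<Rightarrow> 'i \<Rightarrow> ('i \<Rightarrow> 'l \<Rightarrow> int) \<Rightarrow> bool" where
  "recourse_optimal P \<zeta> x s \<xi> i =
     is_arg_max (recourse_objective P i) (recourse_feasible \<zeta> x s \<xi> i)"

definition price_hat ::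
  "('i \<Rightarrow> 'i \<Rightarrow> 'l \<Rightarrow> real) \<Rightarrow> ('i \<Rightarrow> 'z) \<Rightarrow> ('z \<Rightarrow> 'z \<Rightarrow> 'l \<Rightarrow> int) \<Rightarrow>
   'i \<Rightarrow> 'i \<times> 'l \<Rightarrow> real" where
  "price_hat P \<zeta> x i = (\<lambda>(j, l). P i j l * real_of_int (x (\<zeta> i) (\<zeta> j) l))"

definition max_rentals ::
  "('v::finite \<Rightarrow> 'i::finite \<Rightarrow> int) \<Rightarrow> ('i \<Rightarrow> 'i \<Rightarrow> int) \<Rightarrow> 'i \<Rightarrow> 'i \<Rightarrow> int" where
  "max_rentals s \<xi> i j =
     min (\<xi> i j) \<lfloor>theta \<xi> i j * real_of_int (vehicles_at s i) + 1\<rfloor>"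

text \<open>
  The pairs \<open>e 1, e 2, \<dots>\<close> enumerate the offered (destination, price level) pairs and
  \<open>kh\<close> is the critical index. The subtraction from the vehicle count is on \<^typ>\<open>int\<close>, hence not truncated.
\<close>

definition r_hat ::
  "('v::finite \<Rightarrow> 'i::finite \<Rightarrow> int) \<Rightarrow> ('i \<Rightarrow> 'i \<Rightarrow> int) \<Rightarrow> 'i \<Rightarrow> (nat \<Rightarrow> 'i \<times> 'l) \<Rightarrow> nat \<Rightarrow>
   'i \<Rightarrow> 'l \<Rightarrow> int" where
  "r_hat s \<xi> i e kh j l =
     (if (j, l) \<in> e ` {1..kh - 1} then max_rentals s \<xi> i j
      else if (j, l) = e kh then
        vehicles_at s i - (\<Sum>k = 1..kh - 1. max_rentals s \<xi> i (fst (e k)))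
      else 0)"

end

theory Submission
  imports Defs
begin

text \<open>
  On the offered pairs, the recourse problem of one station is a knapsack problem in which every
  item has unit weight: the capacity of a pair is \<^const>\<open>max_rentals\<close> of its destination (an integer
  is at most a real bound iff it is at most the floor of that bound), and the common budget is the
  number of vehicles. On every other pair the demand constraint forces the value \<open>0\<close>. Hence filling
  the most expensive pairs first is optimal.

  The optimality of the greedy solution \<open>r\<close> is a duality argument whose multiplier for the budget is
  the price \<open>p b\<close> of the critical pair \<open>b\<close>. For every competitor \<open>q\<close> the products
  \<open>(p a - p b) * (r a - q a)\<close> are nonnegative: in \<open>r\<close>, pairs ranked before \<open>b\<close> are full and pairs
  ranked after it are empty. Summing gives \<open>\<Sum> p (r - q) \<ge> p b * \<Sum> (r - q)\<close>, and the right-hand side is nonnegative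
  because \<open>r\<close> exhausts the budget (lemma \<open>greedy_filling_optimal\<close>).
\<close>

lemma greedy_filling_optimal:
  fixes p q r c :: "'a \<Rightarrow> real"
  assumes "0 \<le> p b"
    and dear: "\<And>a. a \<in> K \<Longrightarrow> p b \<le> p a"
    and cheap: "\<And>a. a \<in> A - insert b K \<Longrightarrow> p a \<le> p b"
    and full: "\<And>a. a \<in> K \<Longrightarrow> r a = c a"
    and empty: "\<And>a. a \<in> A - insert b K \<Longrightarrow> r a = 0"
    and q: "\<And>a. a \<in> A \<Longrightarrow> 0 \<le> q a \<and> q a \<le> c a"
    and budget: "sum q A \<le> sum r A"
  shows "(\<Sum>a\<in>A. p a * q a) \<le> (\<Sum>a\<in>A. p a * r a)"
proof -
  have "0 \<le> (p a - p b) * (r a - q a)" if "a \<in> A" for a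
  proof (cases "a \<in> K")
    case True
    then show ?thesis
      using dear[OF True] full[OF True] q[OF that] by simp
  next
    case False
    show ?thesis
    proof (cases "a = b")
      case other: False
      with False that have "a \<in> A - insert b K" by blast
      with cheap[OF this] empty[OF this] q[OF that] show ?thesis
        by (simp add: mult_nonpos_nonneg)
    qed simp
  qed
  then have "0 \<le> (\<Sum>a\<in>A. (p a - p b) * (r a - q a))"
    by (rule sum_nonneg)
  also have "\<dots> = (\<Sum>a\<in>A. p a * r a) - (\<Sum>a\<in>A. p a * q a) - p b * (sum r A - sum q A)"
    by (simp add: algebra_simps sum.distrib sum_subtractf sum_distrib_left)
  finally show ?thesis
    using mult_nonneg_nonneg[OF \<open>0 \<le> p b\<close>, of "sum r A - sum q A"] budget by simp
qed

definition offered ::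
  "('i \<Rightarrow> 'z) \<Rightarrow> ('z \<Rightarrow> 'z \<Rightarrow> 'l \<Rightarrow> int) \<Rightarrow> 'i \<Rightarrow> ('i \<times> 'l) set" where
  "offered \<zeta> x i = {(j, l). j \<in> dests i \<and> x (\<zeta> i) (\<zeta> j) l = 1}"

lemma sum_offered:
  fixes f :: "'i::finite \<Rightarrow> 'l::finite \<Rightarrow> 'a::comm_monoid_add"
  assumes "\<And>j l. j \<in> dests i \<Longrightarrow> (j, l) \<notin> offered \<zeta> x i \<Longrightarrow> f j l = 0"
  shows "(\<Sum>(j, l)\<in>dests i \<times> UNIV. f j l) = (\<Sum>(j, l)\<in>offered \<zeta> x i. f j l)"
  by (rule sum.mono_neutral_right) (use assms in \<open>auto simp: offered_def\<close>)

lemma recourse_objective_offered: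
  assumes "\<And>j l. j \<in> dests i \<Longrightarrow> (j, l) \<notin> offered \<zeta> x i \<Longrightarrow> r j l = 0"
  shows "recourse_objective P i r
    = (\<Sum>(j, l)\<in>offered \<zeta> x i. P i j l * real_of_int (r j l))"
  unfolding recourse_objective_def sum.cartesian_product
  by (rule sum_offered) (simp add: assms)

lemma le_max_rentals_iff:
  "n \<le> max_rentals s \<xi> i j \<longleftrightarrow>
     n \<le> \<xi> i j \<and> real_of_int n \<le> theta \<xi> i j * real_of_int (vehicles_at s i) + 1"
  unfolding max_rentals_def min.bounded_iff le_floor_iff ..

text \<open>
  A pair that is not offered has \<open>x = 0\<close>, so its demand constraint leaves only the value \<open>0\<close>;
  nonnegativity of the capacity ensures that this value also meets the proportional bound.
\<close>

lemma recourse_feasible_iff: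
  fixes x :: "'z \<Rightarrow> 'z \<Rightarrow> 'l::finite \<Rightarrow> int" and s :: "'v::finite \<Rightarrow> 'i::finite \<Rightarrow> int"
  assumes binary: "\<And>z1 z2 l. x z1 z2 l \<in> {0, 1}"
    and cap: "\<forall>j\<in>dests i. 0 \<le> max_rentals s \<xi> i j"
  shows "recourse_feasible \<zeta> x s \<xi> i r \<longleftrightarrow>
    (\<forall>(j, l)\<in>offered \<zeta> x i. 0 \<le> r j l \<and> r j l \<le> max_rentals s \<xi> i j) \<and>
    (\<forall>j\<in>dests i. \<forall>l. (j, l) \<notin> offered \<zeta> x i \<longrightarrow> r j l = 0) \<and>
    (\<Sum>(j, l)\<in>offered \<zeta> x i. r j l) \<le> vehicles_at s i"
    (is "_ \<longleftrightarrow> ?caps \<and> ?zeros \<and> ?budget")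
proof -
  have point: "(r j l \<le> \<xi> i j * x (\<zeta> i) (\<zeta> j) l \<and>
      real_of_int (r j l) \<le> theta \<xi> i j * real_of_int (vehicles_at s i) + 1 \<and> 0 \<le> r j l)
    \<longleftrightarrow> (if (j, l) \<in> offered \<zeta> x i then 0 \<le> r j l \<and> r j l \<le> max_rentals s \<xi> i j
         else r j l = 0)" if "j \<in> dests i" for j l
  proof (cases "x (\<zeta> i) (\<zeta> j) l = 1")
    case True
    with that show ?thesis by (auto simp: offered_def le_max_rentals_iff)
  next
    case False
    with binary[of "\<zeta> i" "\<zeta> j" l] have "x (\<zeta> i) (\<zeta> j) l = 0" by auto
    with cap that show ?thesis
      by (auto simp: offered_def le_max_rentals_iff)
  qed
  have pointwise: "(\<forall>j\<in>dests i. \<forall>l. r j l \<le> \<xi> i j * x (\<zeta> i) (\<zeta> j) l \<and>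
      real_of_int (r j l) \<le> theta \<xi> i j * real_of_int (vehicles_at s i) + 1 \<and> 0 \<le> r j l)
    \<longleftrightarrow> ?caps \<and> ?zeros"
    by (simp add: point) (auto simp: offered_def)
  have "(\<Sum>(j, l)\<in>dests i \<times> UNIV. r j l) = (\<Sum>(j, l)\<in>offered \<zeta> x i. r j l)" if ?zeros
    by (rule sum_offered) (use that in blast)
  then show ?thesis
    unfolding recourse_feasible_def pointwise by auto
qed

lemma max_rentals_nonneg:
  assumes "\<And>j. j \<in> dests i \<Longrightarrow> 0 \<le> \<xi> i j" and "0 \<le> vehicles_at s i" and "j \<in> dests i"
  shows "0 \<le> max_rentals s \<xi> i j"
proof -
  have "{k. k \<noteq> i} = dests i" by (auto simp: dests_def arcs_def)
  then have "0 \<le> (\<Sum>k | k \<noteq> i. \<xi> i k)"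
    using assms(1) by (metis sum_nonneg)
  then have "0 \<le> theta \<xi> i j"
    using assms by (simp add: theta_def flip: of_int_sum)
  then show ?thesis
    using assms by (simp add: le_max_rentals_iff)
qed

text \<open>The critical pair takes exactly the vehicles left over, so the budget is exhausted.\<close>

lemma sum_r_hat:
  fixes e :: "nat \<Rightarrow> 'i::finite \<times> 'l::finite"
  assumes inj: "inj_on e {1..n}" and kh: "1 \<le> kh" "kh \<le> n"
    and sub: "e ` {1..n} \<subseteq> A"
  shows "(\<Sum>(j, l)\<in>A. r_hat s \<xi> i e kh j l) = vehicles_at s i"
proof -
  let ?K = "e ` {1..kh - 1}"
  let ?r = "\<lambda>(j, l). r_hat s \<xi> i e kh j l"
  have notin: "e kh \<notin> ?K"
    using inj kh by (auto dest!: inj_onD)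
  have injK: "inj_on e {1..kh - 1}"
    by (rule inj_on_subset[OF inj]) (use kh in auto)
  have "insert (e kh) ?K \<subseteq> A"
    using sub kh by (auto intro!: subsetD[OF sub])
  then have "sum ?r A = sum ?r (insert (e kh) ?K)"
    by (intro sum.mono_neutral_right) (auto simp: r_hat_def split: if_splits)
  also have "\<dots> = ?r (e kh) + sum ?r ?K"
    using notin by simp
  also have "sum ?r ?K = (\<Sum>k = 1..kh - 1. max_rentals s \<xi> i (fst (e k)))"
    unfolding sum.reindex[OF injK] by (intro sum.cong) (auto simp: r_hat_def split_beta)
  also have "?r (e kh) = vehicles_at s i - (\<Sum>k = 1..kh - 1. max_rentals s \<xi> i (fst (e k)))"
    using notin by (simp add: r_hat_def split_beta)
  finally show ?thesis by simp
qed

theorem propositionA2: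
  fixes P :: "'i::finite \<Rightarrow> 'i \<Rightarrow> 'l::finite \<Rightarrow> real"
    and \<zeta> :: "'i \<Rightarrow> 'z::finite"
    and x :: "'z \<Rightarrow> 'z \<Rightarrow> 'l \<Rightarrow> int"
    and s :: "'v::finite \<Rightarrow> 'i \<Rightarrow> int"
    and \<xi> :: "'i \<Rightarrow> 'i \<Rightarrow> int"
    and ih :: 'i
    and e :: "nat \<Rightarrow> 'i \<times> 'l"
    and kh :: nat
  assumes "\<And>i j l. (i, j) \<in> arcs \<Longrightarrow> 0 \<le> P i j l"
    and "(x, s) \<in> first_stage"
    and "\<And>i j. (i, j) \<in> arcs \<Longrightarrow> 0 \<le> \<xi> i j"
    and "vehicles_at s ih < (\<Sum>j | (ih, j) \<in> arcs. \<xi> ih j)"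
    and "bij_betw e {1..card (dests ih)} {(j, l). j \<in> dests ih \<and> x (\<zeta> ih) (\<zeta> j) l = 1}"
    and "\<And>k k'. 1 \<le> k \<Longrightarrow> k \<le> k' \<Longrightarrow> k' \<le> card (dests ih) \<Longrightarrow>
           price_hat P \<zeta> x ih (e k') \<le> price_hat P \<zeta> x ih (e k)"
    and "2 \<le> kh" and "kh \<le> card (dests ih)"
    and "(\<Sum>k = 1..kh - 1. max_rentals s \<xi> ih (fst (e k))) \<le> vehicles_at s ih"
    and "(\<Sum>k = 1..kh. max_rentals s \<xi> ih (fst (e k))) > vehicles_at s ih"
  shows "recourse_optimal P \<zeta> x s \<xi> ih (r_hat s \<xi> ih e kh)"
proof -
  note P_nonneg = assms(1) and xi_nonneg = assms(3) and enum = assms(5) and mono = assms(6)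
    and kh = assms(7,8) and fits = assms(9) and exceeds = assms(10)
  define A where "A = offered \<zeta> x ih"
  define n where "n = card (dests ih)"
  define K where "K = e ` {1..kh - 1}"
  let ?r = "r_hat s \<xi> ih e kh"
  let ?c = "max_rentals s \<xi> ih"
  have binary: "x z1 z2 l \<in> {0, 1}" for z1 z2 l
    using assms(2) by (simp add: first_stage_def)
  have "0 \<le> s v i" for v i
    using assms(2) by (auto simp: first_stage_def dest!: spec[of _ v] spec[of _ i])
  then have "0 \<le> vehicles_at s ih"
    by (simp add: vehicles_at_def sum_nonneg)
  then have cap: "\<forall>j\<in>dests ih. 0 \<le> ?c j"
    using xi_nonneg by (intro ballI max_rentals_nonneg) (auto simp: dests_def)
  note feasible_iff = recourse_feasible_iff[where \<zeta> = \<zeta> and x = x, OF binary cap, folded A_def]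
  have inj: "inj_on e {1..n}" and range: "e ` {1..n} = A"
    using enum by (auto simp: bij_betw_def A_def n_def offered_def)
  have in_A: "j \<in> dests ih \<and> x (\<zeta> ih) (\<zeta> j) l = 1" if "(j, l) \<in> A" for j l
    using that by (simp add: A_def offered_def)
  have b_in_A: "e kh \<in> A" and "K \<subseteq> A"
    using range kh by (auto simp: K_def n_def)

  \<comment> \<open>The leftover fits into the critical pair: split off the last summand of the exceeding sum.\<close>
  have "{1..kh} = insert kh {1..kh - 1}" and "kh \<notin> {1..kh - 1}"
    using kh by auto
  then have "vehicles_at s ih - (\<Sum>k = 1..kh - 1. ?c (fst (e k))) \<le> ?c (fst (e kh))"
    using exceeds by simp
  then have r_cap: "0 \<le> ?r j l \<and> ?r j l \<le> ?c j" if "(j, l) \<in> A" for j l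
    using fits cap in_A[OF that] by (auto simp: r_hat_def) (metis fst_conv)+
  have r_full: "?r j l = ?c j" if "(j, l) \<in> K" for j l
    using that unfolding r_hat_def K_def by (rule if_P)
  have r_zero: "?r j l = 0" if "(j, l) \<notin> insert (e kh) K" for j l
    using that by (auto simp: r_hat_def K_def)
  have r_outside: "?r j l = 0" if "(j, l) \<notin> A" for j l
    by (rule r_zero) (use that b_in_A \<open>K \<subseteq> A\<close> in fastforce)
  have r_sum: "(\<Sum>(j, l)\<in>A. ?r j l) = vehicles_at s ih"
    using kh by (intro sum_r_hat[OF inj]) (auto simp: n_def simp flip: range)
  have r_feasible: "recourse_feasible \<zeta> x s \<xi> ih ?r"
    unfolding feasible_iff using r_cap r_outside r_sum by auto

  have "recourse_objective P ih q \<le> recourse_objective P ih ?r"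
    if feasible: "recourse_feasible \<zeta> x s \<xi> ih q" for q
  proof -
    let ?p = "\<lambda>(j, l). P ih j l"
    have q: "\<And>j l. (j, l) \<in> A \<Longrightarrow> 0 \<le> q j l \<and> q j l \<le> ?c j"
      and q_zero: "\<And>j l. j \<in> dests ih \<Longrightarrow> (j, l) \<notin> A \<Longrightarrow> q j l = 0"
      and q_sum: "(\<Sum>(j, l)\<in>A. q j l) \<le> vehicles_at s ih"
      using feasible unfolding feasible_iff by auto
    have price: "price_hat P \<zeta> x ih a = ?p a" if "a \<in> A" for a
      using that by (cases a) (simp add: price_hat_def in_A)
    have p_mono: "?p (e k') \<le> ?p (e k)" if "1 \<le> k" "k \<le> k'" "k' \<le> n" for k k'
    proof -
      have "e k \<in> A" and "e k' \<in> A"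
        using that range by auto
      then show ?thesis
        using mono[of k k'] that by (simp only: price n_def)
    qed
    have "(\<Sum>a\<in>A. ?p a * (\<lambda>(j, l). real_of_int (q j l)) a)
      \<le> (\<Sum>a\<in>A. ?p a * (\<lambda>(j, l). real_of_int (?r j l)) a)"
    proof (rule greedy_filling_optimal[where b = "e kh" and K = K
          and c = "\<lambda>(j, l). real_of_int (?c j)"])
      show "0 \<le> ?p (e kh)"
        using P_nonneg b_in_A by (auto simp: dests_def dest!: in_A split: prod.split)
    next
      fix a assume "a \<in> K"
      then show "?p (e kh) \<le> ?p a"
        using kh by (auto simp only: K_def n_def image_iff atLeastAtMost_iff intro!: p_mono)
    next
      fix a assume "a \<in> A - insert (e kh) K"
      then have "a \<in> A" and "a \<notin> K" by auto
      then obtain k where k: "a = e k" "1 \<le> k" "k \<le> n"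
        using range by auto
      with \<open>a \<notin> K\<close> have "kh \<le> k"
        by (force simp: K_def)
      then show "?p a \<le> ?p (e kh)"
        unfolding \<open>a = e k\<close> using kh k by (intro p_mono) auto
    next
      fix a assume "a \<in> K"
      then show "(\<lambda>(j, l). real_of_int (?r j l)) a = (\<lambda>(j, l). real_of_int (?c j)) a"
        using r_full by (cases a) simp
    next
      fix a assume "a \<in> A - insert (e kh) K"
      then show "(\<lambda>(j, l). real_of_int (?r j l)) a = 0"
        using r_zero by (auto split: prod.split)
    next
      fix a assume "a \<in> A"
      then show "0 \<le> (\<lambda>(j, l). real_of_int (q j l)) a \<and>
          (\<lambda>(j, l). real_of_int (q j l)) a \<le> (\<lambda>(j, l). real_of_int (?c j)) a"
        using q by (auto split: prod.split)
    next
      have "real_of_int (\<Sum>(j, l)\<in>A. q j l) \<le> real_of_int (\<Sum>(j, l)\<in>A. ?r j l)"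
        unfolding of_int_le_iff r_sum by (rule q_sum)
      then show "(\<Sum>(j, l)\<in>A. real_of_int (q j l)) \<le> (\<Sum>(j, l)\<in>A. real_of_int (?r j l))"
        by (simp only: of_int_sum case_prod_unfold)
    qed
    moreover have "recourse_objective P ih q = (\<Sum>(j, l)\<in>A. P ih j l * real_of_int (q j l))"
      unfolding A_def by (rule recourse_objective_offered) (use q_zero in \<open>simp add: A_def\<close>)
    moreover have "recourse_objective P ih ?r = (\<Sum>(j, l)\<in>A. P ih j l * real_of_int (?r j l))"
      unfolding A_def by (rule recourse_objective_offered) (use r_outside in \<open>simp add: A_def\<close>)
    ultimately show ?thesis
      by (simp only: case_prod_unfold)
  qed
  then show ?thesis
    using r_feasible by (auto simp: recourse_optimal_def is_arg_max_linorder)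
qed

end
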